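(* For every $c>0$ and $\varepsilon>0$ there is $n_0$ such that for all $n>n_0$ the following holds. Let $\ell_1,\ell_2$ be lines in $\mathbb{R}^2$, let $P_1$ be a set of $n$ points on $\ell_1$ and $P_2$ a set of $n^{1/2+\varepsilon}$ points on $\ell_2$. If $|D(P_1,P_2)|<cn$, then $\ell_1$ and $\ell_2$ are parallel or orthogonal.
   Context: For point sets $P,Q\subset\mathbb{R}^2$, $D(P,Q)=\{d(p,q): p\in P,\ q\in Q\}$ denotes the set of Euclidean distances between a point of $P$ and a point of $Q$. *)

theory Defs
  imports "HOL-Analysis.Analysis"
begin

definition line_through :: "real^2 \<Rightarrow> real^2 \<Rightarrow> (real^2) set" where
  "line_through p v = {p + t *\<^sub>R v | t. True}"

definition is_line :: "(real^2) set \<Rightarrow> bool" where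
  "is_line L \<longleftrightarrow> (\<exists>p v. v \<noteq> 0 \<and> L = line_through p v)"

definition parallel_or_orthogonal :: "(real^2) set \<Rightarrow> (real^2) set \<Rightarrow> bool" where
  "parallel_or_orthogonal L1 L2 \<longleftrightarrow>
     (\<exists>p1 v1 p2 v2. v1 \<noteq> 0 \<and> v2 \<noteq> 0 \<and> L1 = line_through p1 v1 \<and> L2 = line_through p2 v2 \<and>
        (v1$1 * v2$2 - v1$2 * v2$1 = 0 \<or> inner v1 v2 = 0))"

definition dist_set :: "(real^2) set \<Rightarrow> (real^2) set \<Rightarrow> real set" where
  "dist_set P Q = {dist p q | p q. p \<in> P \<and> q \<in> Q}"

end

theory Submission
  imports Defs "HOL-Computational_Algebra.Polynomial" "HOL-Real_Asymp.Real_Asymp"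
begin

text \<open>Put the intersection point of the two lines at the origin and let \<open>l\<close> be the cosine of
  their angle, so that \<open>0 < l\<^sup>2 < 1\<close> and squared distances are \<open>x\<^sup>2 - 2 l x y + y\<^sup>2\<close>. For fixed
  \<open>y\<close> this is unimodal in \<open>x\<close>; hence for most pairs of consecutive \<open>x, x'\<close> of \<open>P\<^sub>1\<close> the two
  distances to \<open>y\<close> are within \<open>O(1)\<close> of each other in the ordering of the distance set \<open>D\<close>, as
  \<open>|D| = O(n)\<close>. Therefore \<open>(x, x', y, y')\<close>, with \<open>x, x'\<close> consecutive and \<open>y, y'\<close> arbitrary, yields
  on the order of \<open>n m\<^sup>2\<close> quadruples of distances forming two close pairs, while there are only
  \<open>O(n\<^sup>2)\<close> such quadruples. Four distances determine \<open>(x, x', y, y')\<close> up to four choices, so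
  \<open>m\<^sup>2 = O(n)\<close>, with a constant independent of the angle.\<close>

section \<open>Quadruples with four prescribed distances\<close>

definition sqdist :: "real \<Rightarrow> real \<Rightarrow> real \<Rightarrow> real" where
  "sqdist l x y = x\<^sup>2 - 2 * l * x * y + y\<^sup>2"

text \<open>The data yield a nonzero quartic with root \<open>x - x'\<close>, and this difference
  then fixes all four coordinates. The condition \<open>l \<noteq> 0\<close> lets the product of the
  two differences be read off from the mixed difference of the data.\<close>

lemma quadruples_sqdist_bound:
  fixes l a b a' b' :: real
  assumes l0: "l \<noteq> 0" and l1: "l\<^sup>2 < 1"
  defines "S \<equiv> {(x, x', y, y'). x \<noteq> x' \<and> y \<noteq> y' \<and> sqdist l x y = a \<and> sqdist l x' y = b \<and>
                  sqdist l x y' = a' \<and> sqdist l x' y' = b'}"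
  shows "finite S \<and> card S \<le> 4"
proof (cases "S = {}")
  case False
  \<comment> \<open>\<open>k\<close>, \<open>A\<close>, \<open>B\<close> express \<open>y - y'\<close>, \<open>x + x'\<close> and \<open>y + y'\<close> through \<open>p = x - x'\<close>; substituting these
    into the equation for \<open>C\<close> and multiplying by \<open>E k\<^sup>2 p\<^sup>2\<close> yields the quartic \<open>r\<close> in \<open>p\<close>.\<close>
  define k where "k = ((a' - b') - (a - b)) / (2 * l)"
  define A where "A = (a - b + a' - b') / 2"
  define B where "B = (a - a' + b - b') / 2"
  define C where "C = a + b + a' + b'"
  define E where "E = 1 - l\<^sup>2"
  define r where "r = [: k\<^sup>2 * (E * k\<^sup>2 + A\<^sup>2), 0, 2 * l * A * B * k - C * E * k\<^sup>2, 0, E * k\<^sup>2 + B\<^sup>2 :]"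
  define g where "g = (\<lambda>(x::real, x'::real, y::real, y'::real). x - x')"
  have E0: "E > 0" using l1 by (simp add: E_def)
  have params: "k = (x - x') * (y - y') \<and> A = (x - x') * ((x + x') - l * (y + y')) \<and>
        B = (y - y') * ((y + y') - l * (x + x')) \<and>
        C = (x + x')\<^sup>2 + (x - x')\<^sup>2 + (y + y')\<^sup>2 + (y - y')\<^sup>2 - 2 * l * (x + x') * (y + y')"
    if "(x, x', y, y') \<in> S" for x x' y y'
  proof -
    have e: "a = sqdist l x y" "b = sqdist l x' y" "a' = sqdist l x y'" "b' = sqdist l x' y'"
      using that by (auto simp: S_def)
    show ?thesis
      using l0 unfolding k_def A_def B_def C_def e sqdist_def
      by (simp add: field_simps power2_eq_square)
  qed
  \<comment> \<open>A member of \<open>S\<close> has \<open>x \<noteq> x'\<close> and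
    \<open>y \<noteq> y'\<close>, so the product \<open>k\<close> is nonzero; with
    \<open>E > 0\<close> the leading coefficient of \<open>r\<close> is then positive.\<close>
  have k0: "k \<noteq> 0"
    using False params by (fastforce simp: S_def)
  have r0: "r \<noteq> 0"
    using E0 k0 by (simp add: r_def add_pos_nonneg less_imp_neq[symmetric])
  have "poly r (g z) = 0" if "z \<in> S" for z
  proof -
    obtain x x' y y' where z: "z = (x, x', y, y')" by (cases z)
    define p q s t where "p = x - x'" and "q = y - y'" and "s = x + x'" and "t = y + y'"
    have e: "k = p * q" "A = p * (s - l * t)" "B = q * (t - l * s)"
      "C = s\<^sup>2 + p\<^sup>2 + t\<^sup>2 + q\<^sup>2 - 2 * l * s * t"
      using params[of x x' y y'] that unfolding z p_def q_def s_def t_def by auto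
    have "poly r p = 0"
      unfolding r_def E_def e by (simp add: algebra_simps power2_eq_square)
    then show ?thesis by (simp add: z g_def p_def)
  qed
  then have sub: "g ` S \<subseteq> {p. poly r p = 0}" by auto
  \<comment> \<open>Given \<open>p\<close>, the value \<open>k\<close> yields \<open>q\<close>; then
    \<open>A\<close> and \<open>B\<close> yield \<open>s - l * t\<close> and
    \<open>t - l * s\<close>, a linear system in \<open>s\<close>, \<open>t\<close> with determinant
    \<open>E\<close>.\<close>
  have "inj_on g S"
  proof (rule inj_onI)
    fix z w assume zw: "z \<in> S" "w \<in> S" "g z = g w"
    obtain x x' y y' where z: "z = (x, x', y, y')" by (cases z)
    obtain u u' v v' where w: "w = (u, u', v, v')" by (cases w)
    define p q s t where "p = x - x'" and "q = y - y'" and "s = x + x'" and "t = y + y'"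
    define q2 s2 t2 where "q2 = v - v'" and "s2 = u + u'" and "t2 = v + v'"
    have p: "p = u - u'" using zw(3) by (simp add: z w g_def p_def)
    have pq0: "p \<noteq> 0" "q \<noteq> 0" using zw(1) by (auto simp: z S_def p_def q_def)
    have 1: "k = p * q" "A = p * (s - l * t)" "B = q * (t - l * s)"
      using params[of x x' y y'] zw(1) unfolding z p_def q_def s_def t_def by auto
    have 2: "k = p * q2" "A = p * (s2 - l * t2)" "B = q2 * (t2 - l * s2)"
      using params[of u u' v v'] zw(2) unfolding w p q2_def s2_def t2_def by auto
    have q: "q = q2" using 1 2 pq0 by auto
    have st: "s - l * t = s2 - l * t2" "t - l * s = t2 - l * s2"
      using 1 2 pq0 q by auto
    have "E * s = (s - l * t) + l * (t - l * s)"
      by (simp add: E_def algebra_simps power2_eq_square)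
    also have "\<dots> = E * s2"
      unfolding st by (simp add: E_def algebra_simps power2_eq_square)
    finally have s: "s = s2" using E0 by simp
    then have "t = t2" using st(2) by simp
    then show "z = w" using p q s
      unfolding z w p_def q_def s_def t_def q2_def s2_def t2_def by simp
  qed
  moreover have "finite (g ` S)"
    using sub poly_roots_finite[OF r0] by (rule finite_subset)
  moreover have "card (g ` S) \<le> 4"
  proof -
    have "card (g ` S) \<le> card {p. poly r p = 0}"
      using sub poly_roots_finite[OF r0] by (rule card_mono[rotated])
    also have "\<dots> \<le> degree r" by (rule card_poly_roots_bound[OF r0])
    also have "\<dots> \<le> 4" by (simp add: r_def)
    finally show ?thesis .
  qed
  ultimately show ?thesis by (simp add: card_image finite_image_iff)
qed simp

section \<open>Ranks and close pairs in a finite ordered set\<close>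

definition rank_in :: "'a::linorder set \<Rightarrow> 'a \<Rightarrow> nat" where
  "rank_in D a = card {e \<in> D. e < a}"

lemma rank_in_mono: "finite D \<Longrightarrow> a \<le> b \<Longrightarrow> rank_in D a \<le> rank_in D b"
  unfolding rank_in_def by (rule card_mono) auto

lemma rank_in_less_card:
  assumes "finite D" "a \<in> D"
  shows "rank_in D a < card D"
  unfolding rank_in_def using assms by (intro psubset_card_mono) auto

lemma inj_on_rank_in:
  assumes "finite D"
  shows "inj_on (rank_in D) D"
proof (rule linorder_inj_onI)
  fix a b assume "a < b" "a \<in> D" "b \<in> D"
  then have "rank_in D a < rank_in D b"
    unfolding rank_in_def using assms by (intro psubset_card_mono) auto
  then show "rank_in D a \<noteq> rank_in D b" by simp
qed auto

definition close_pairs :: "nat \<Rightarrow> 'a::linorder set \<Rightarrow> ('a \<times> 'a) set" where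
  "close_pairs T D = {(a, b) \<in> D \<times> D. \<bar>int (rank_in D a) - int (rank_in D b)\<bar> \<le> int T}"

lemma finite_close_pairs: "finite D \<Longrightarrow> finite (close_pairs T D)"
  by (rule finite_subset[of _ "D \<times> D"]) (auto simp: close_pairs_def)

text \<open>A close pair is encoded by its first entry and the rank difference, one of
  \<open>2 * T + 1\<close> integers; injectivity of the rank recovers the second entry.\<close>

lemma card_close_pairs:
  assumes "finite D"
  shows "card (close_pairs T D) \<le> card D * (2 * T + 1)"
proof -
  define f where "f = (\<lambda>(a, b). (a, int (rank_in D b) - int (rank_in D a)))"
  have "inj_on f (close_pairs T D)"
    using inj_on_rank_in[OF assms] by (auto simp: inj_on_def f_def close_pairs_def)
  moreover have "f ` close_pairs T D \<subseteq> D \<times> {- int T..int T}"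
    by (auto simp: f_def close_pairs_def)
  ultimately have "card (close_pairs T D) \<le> card (D \<times> {- int T..int T})"
    using assms by (intro card_inj_on_le) auto
  also have "\<dots> = card D * (2 * T + 1)"
  proof -
    have "card {- int T..int T} = 2 * T + 1"
      unfolding card_atLeastAtMost_int by linarith
    then show ?thesis by (simp only: card_cartesian_product)
  qed
  finally show ?thesis .
qed

text \<open>The increments are nonnegative and telescope, and each large one contributes at least
  \<open>T\<close>.\<close>

lemma card_large_jumps:
  fixes h :: "nat \<Rightarrow> int"
  assumes mono: "\<And>i. i < N \<Longrightarrow> h i \<le> h (Suc i)"
  shows "int (card {i. i < N \<and> h (Suc i) - h i > int T}) * int T \<le> h N - h 0"
proof -
  let ?J = "{i. i < N \<and> h (Suc i) - h i > int T}"
  have "int (card ?J) * int T = (\<Sum>i\<in>?J. int T)" by simp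
  also have "\<dots> \<le> (\<Sum>i\<in>?J. h (Suc i) - h i)" by (rule sum_mono) auto
  also have "\<dots> \<le> (\<Sum>i<N. h (Suc i) - h i)"
    using mono by (intro sum_mono2) auto
  also have "\<dots> = h N - h 0" by (rule sum_lessThan_telescope)
  finally show ?thesis .
qed

text \<open>Completing the square: \<open>l * y\<close> is the foot of the perpendicular, so for
  fixed \<open>y\<close> the value grows with the distance from \<open>x\<close> to
  \<open>l * y\<close>.\<close>

lemma sqdist_vertex: "sqdist l x y = (x - l * y)\<^sup>2 + (1 - l\<^sup>2) * y\<^sup>2"
  by (simp add: sqdist_def algebra_simps power2_eq_square)

text \<open>Along the sequence the rank falls before the vertex and rises after it, so its total
  variation is at most \<open>2 * card D\<close>, and each far pair uses up more than
  \<open>T\<close> of it.\<close>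

lemma card_far_consecutive:
  fixes x :: "nat \<Rightarrow> real"
  assumes D: "finite D" "\<And>i. i \<le> N \<Longrightarrow> sqdist l (x i) y \<in> D"
    and x: "\<And>i. i < N \<Longrightarrow> x i \<le> x (Suc i)"
  shows "card {i. i < N \<and> (sqdist l (x i) y, sqdist l (x (Suc i)) y) \<notin> close_pairs T D} * T
          \<le> 2 * card D"
proof -
  define \<rho> where "\<rho> i = int (rank_in D (sqdist l (x i) y))" for i
  \<comment> \<open>Negating the rank left of the vertex \<open>l * y\<close> turns the unimodal sequence into a monotone
    one whose jumps still dominate those of the rank.\<close>
  define h where "h i = (if l * y \<le> x i then \<rho> i + 1 else - (\<rho> i + 1))" for i
  have \<rho>_le: "\<rho> i \<le> \<rho> j" if "\<bar>x i - l * y\<bar> \<le> \<bar>x j - l * y\<bar>" for i j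
  proof -
    have "sqdist l (x i) y \<le> sqdist l (x j) y"
      using that by (simp add: sqdist_vertex abs_le_square_iff)
    then show ?thesis unfolding \<rho>_def using rank_in_mono[OF D(1)] by simp
  qed
  have \<rho>0: "0 \<le> \<rho> i" for i by (simp add: \<rho>_def)
  have \<rho>1: "\<rho> i + 1 \<le> int (card D)" if "i \<le> N" for i
    using rank_in_less_card[OF D(1) D(2)[OF that]] by (simp add: \<rho>_def)
  \<comment> \<open>On one side of the vertex the increment of \<open>h\<close> is exactly the
    absolute rank change; across it the increment is \<open>\<rho> i + \<rho> (Suc i) + 2\<close>,
    which is larger than that change.\<close>
  have step: "h i \<le> h (Suc i) \<and> \<bar>\<rho> i - \<rho> (Suc i)\<bar> \<le> h (Suc i) - h i" if "i < N" for i
    using x[OF that] \<rho>_le[of i "Suc i"] \<rho>_le[of "Suc i" i] \<rho>0[of i] \<rho>0[of "Suc i"]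
    by (auto simp: h_def)
  let ?J = "{i. i < N \<and> h (Suc i) - h i > int T}"
  let ?K = "{i. i < N \<and> (sqdist l (x i) y, sqdist l (x (Suc i)) y) \<notin> close_pairs T D}"
  have "?K \<subseteq> ?J"
  proof
    fix i assume i: "i \<in> ?K"
    then have "\<not> \<bar>\<rho> i - \<rho> (Suc i)\<bar> \<le> int T"
      using D(2)[of i] D(2)[of "Suc i"] by (auto simp: close_pairs_def \<rho>_def)
    then show "i \<in> ?J" using i step[of i] by auto
  qed
  then have "int (card ?K) * int T \<le> int (card ?J) * int T"
    by (intro mult_right_mono) (auto intro!: card_mono)
  also have "\<dots> \<le> h N - h 0"
    using step by (intro card_large_jumps) auto
  also have "\<dots> \<le> 2 * int (card D)"
    using \<rho>1[of 0] \<rho>1[of N] \<rho>0[of 0] \<rho>0[of N] by (auto simp: h_def)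
  finally have "int (card ?K * T) \<le> int (2 * card D)" by simp
  then show ?thesis by linarith
qed

section \<open>Double counting of close quadruples\<close>

lemma card_le_fibres:
  assumes "finite N" "f ` Q \<subseteq> N"
    and "\<And>b. b \<in> N \<Longrightarrow> card {q \<in> Q. f q = b} \<le> k"
  shows "card Q \<le> k * card N"
proof -
  have "Q = (\<Union>b\<in>N. {q \<in> Q. f q = b})" using assms(2) by auto
  then have "card Q \<le> (\<Sum>b\<in>N. card {q \<in> Q. f q = b})"
    using card_UN_le[OF assms(1)] by metis
  also have "\<dots> \<le> k * card N"
    using sum_bounded_above[of N "\<lambda>b. card {q \<in> Q. f q = b}" k] assms(3)
    by (simp add: mult.commute)
  finally show ?thesis .
qed

text \<open>The set \<open>Q\<close> of two distinct points of \<open>Y\<close> with a gap of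
  \<open>X\<close> good for both is counted twice: from below because most gaps are good, from above
  through the close pairs it produces.\<close>

lemma few_sqdist_imp_small:
  fixes X Y :: "real set" and c l :: real
  assumes fin: "finite X" "finite Y" and l: "l \<noteq> 0" "l\<^sup>2 < 1"
    and D: "D = (\<lambda>(x, y). sqdist l x y) ` (X \<times> Y)"
    and cD: "real (card D) \<le> c * real (card X)"
    and T: "8 * c \<le> real T" "0 < T" and n4: "4 \<le> card X"
  shows "real (card Y) * (real (card Y) - 1) \<le> 16 * c\<^sup>2 * (2 * real T + 1)\<^sup>2 * real (card X)"
proof -
  define n m where "n = card X" and "m = card Y"
  define N where "N = n - 1"
  define x where "x i = sorted_list_of_set X ! i" for i
  have len: "length (sorted_list_of_set X) = n" by (simp add: n_def)
  have x_less: "x i < x j" if "i < j" "j < n" for i j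
    using sorted_wrt_nth_less[OF strict_sorted_list_of_set[of X] that(1)] that(2)
    by (simp add: x_def n_def)
  have x_inj: "i = j" if "x i = x j" "i < n" "j < n" for i j
    using x_less[of i j] x_less[of j i] that by (cases i j rule: linorder_cases) auto
  have xX: "x i \<in> X" if "i < n" for i
    using nth_mem[of i "sorted_list_of_set X"] that len fin by (simp add: x_def)
  have fD: "finite D" using fin by (simp add: D)
  have inD: "sqdist l (x i) y \<in> D" if "i < n" "y \<in> Y" for i y
    using xX[OF that(1)] that(2) by (auto simp: D)
  have N: "Suc N = n" using n4 by (simp add: N_def n_def)
  define F where "F i y = (sqdist l (x i) y, sqdist l (x (Suc i)) y)" for i y
  define bad where "bad y = {i. i < N \<and> F i y \<notin> close_pairs T D}" for y
  \<comment> \<open>The choice \<open>T \<ge> 8 * c\<close> is made here: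
    \<open>2 * card D / T\<close> is then at most \<open>n / 4\<close>.\<close>
  have bad: "4 * card (bad y) \<le> n" if "y \<in> Y" for y
  proof -
    have "card (bad y) * T \<le> 2 * card D"
      unfolding bad_def F_def
      by (rule card_far_consecutive[OF fD]) (use inD that x_less N in \<open>auto simp: less_imp_le\<close>)
    then have "real (card (bad y) * T) \<le> real (2 * card D)" by (rule of_nat_mono)
    then have "real (card (bad y)) * real T \<le> 2 * real (card D)" by simp
    also have "\<dots> \<le> 2 * c * n" using cD by (simp add: n_def)
    also have "\<dots> \<le> real T * n / 4"
      using mult_right_mono[OF T(1), of "real n"] by simp
    finally have "real T * (4 * real (card (bad y))) \<le> real T * real n" by (simp add: algebra_simps)
    then show ?thesis using T(2) by simp
  qed
  define W where "W = {(y, y') \<in> Y \<times> Y. y \<noteq> y'}"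
  define G where "G = (\<lambda>(y, y'). {..<N} - (bad y \<union> bad y'))"
  define Q where "Q = (SIGMA w : W. G w)"
  define \<Phi> where "\<Phi> = (\<lambda>((y, y'), i). (F i y, F i y'))"
  have fW: "finite W" by (rule finite_subset[of _ "Y \<times> Y"]) (use fin in \<open>auto simp: W_def\<close>)
  have cW: "card W = m * m - m"
  proof -
    have "W = Y \<times> Y - (\<lambda>y. (y, y)) ` Y" by (auto simp: W_def)
    moreover have "card ((\<lambda>y. (y, y)) ` Y) = m" by (simp add: card_image inj_on_def m_def)
    ultimately show ?thesis
      using fin by (simp add: card_Diff_subset image_subset_iff card_cartesian_product m_def)
  qed
  \<comment> \<open>Two bad sets of size at most \<open>n / 4\<close> leave at least
    \<open>n / 2 - 1\<close> of the \<open>n - 1\<close> gaps, which is at least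
    \<open>n / 4\<close> once \<open>n \<ge> 4\<close>.\<close>
  have G: "n \<le> 4 * card (G w)" if "w \<in> W" for w
  proof -
    obtain y y' where w: "w = (y, y')" by (cases w)
    have "y \<in> Y" "y' \<in> Y" using that by (auto simp: w W_def)
    then have "4 * card (bad y) \<le> n" "4 * card (bad y') \<le> n" by (simp_all add: bad)
    moreover have "finite (bad y \<union> bad y')" by (simp add: bad_def)
    then have "N - card (bad y \<union> bad y') \<le> card (G w)"
      using diff_card_le_card_Diff[of "bad y \<union> bad y'" "{..<N}"] by (simp add: G_def w)
    ultimately show ?thesis using card_Un_le[of "bad y" "bad y'"] n4 N by (simp add: n_def)
  qed
  have "card W * n = (\<Sum>w\<in>W. n)" by simp
  also have "\<dots> \<le> (\<Sum>w\<in>W. 4 * card (G w))" by (rule sum_mono) (rule G)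
  also have "\<dots> = 4 * card Q"
    using fW by (simp add: Q_def card_SigmaI G_def split_beta sum_distrib_left)
  finally have 1: "card W * n \<le> 4 * card Q" .
  have "card Q \<le> 4 * card (close_pairs T D \<times> close_pairs T D)"
  proof (rule card_le_fibres)
    show "finite (close_pairs T D \<times> close_pairs T D)" using finite_close_pairs[OF fD] by simp
    show "\<Phi> ` Q \<subseteq> close_pairs T D \<times> close_pairs T D"
      by (auto simp: Q_def G_def \<Phi>_def bad_def)
    fix d :: "(real \<times> real) \<times> (real \<times> real)"
    obtain a b a' b' where d: "d = ((a, b), (a', b'))" by (metis surj_pair)
    let ?S = "{(x, x', y, y'). x \<noteq> x' \<and> y \<noteq> y' \<and> sqdist l x y = a \<and> sqdist l x' y = b \<and>
                  sqdist l x y' = a' \<and> sqdist l x' y' = b'}"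
    \<comment> \<open>Since \<open>x\<close> is strictly increasing, the gap index is recovered from
      \<open>x i\<close>, so a fibre of \<open>\<Phi>\<close> embeds into the solution set of the
      quartic argument.\<close>
    let ?f = "\<lambda>((y, y'), i). (x i, x (Suc i), y, y')"
    have "inj_on ?f {q \<in> Q. \<Phi> q = d}"
      using x_inj N by (fastforce simp: inj_on_def Q_def G_def)
    moreover have "x i \<noteq> x (Suc i)" if "i < N" for i using x_less[of i "Suc i"] that N by auto
    then have "?f ` {q \<in> Q. \<Phi> q = d} \<subseteq> ?S"
      by (auto simp: Q_def G_def W_def \<Phi>_def F_def d)
    ultimately have "card {q \<in> Q. \<Phi> q = d} \<le> card ?S"
      using quadruples_sqdist_bound[OF l, of a b a' b'] by (intro card_inj_on_le) auto
    then show "card {q \<in> Q. \<Phi> q = d} \<le> 4"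
      using quadruples_sqdist_bound[OF l, of a b a' b'] by linarith
  qed
  then have "card Q \<le> 4 * (card (close_pairs T D))\<^sup>2"
    by (simp add: card_cartesian_product power2_eq_square)
  also have "\<dots> \<le> 4 * (card D * (2 * T + 1))\<^sup>2"
    using card_close_pairs[OF fD, of T] by (intro mult_left_mono power_mono) auto
  \<comment> \<open>One factor 4 is the density of good gaps, the other the size of the
    fibres.\<close>
  finally have "card W * n \<le> 16 * (card D * (2 * T + 1))\<^sup>2" using 1 by simp
  then have "real (card W * n) \<le> real (16 * (card D * (2 * T + 1))\<^sup>2)" by (rule of_nat_mono)
  then have "real (card W) * n \<le> 16 * (real (card D) * (2 * real T + 1))\<^sup>2"
    by (simp add: algebra_simps)
  also have "\<dots> \<le> 16 * ((c * n) * (2 * real T + 1))\<^sup>2"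
    using cD by (intro mult_left_mono power_mono mult_right_mono) (auto simp: n_def)
  also have "\<dots> = (16 * c\<^sup>2 * (2 * real T + 1)\<^sup>2 * n) * n"
    by (simp add: power2_eq_square algebra_simps)
  finally have "real (card W) \<le> 16 * c\<^sup>2 * (2 * real T + 1)\<^sup>2 * n"
    using n4 by (simp add: n_def)
  moreover have "real (card W) = real m * (real m - 1)"
    by (simp add: cW of_nat_diff algebra_simps)
  ultimately show ?thesis by (simp add: n_def m_def)
qed

section \<open>Lines in the plane and a common frame\<close>

lemma line_through_eq_range: "line_through p v = range (\<lambda>t. p + t *\<^sub>R v)"
  by (auto simp: line_through_def)

lemma line_through_unit:
  assumes "v \<noteq> 0"
  shows "line_through p v = line_through p (v /\<^sub>R norm v)"
proof -
  have "p + t *\<^sub>R v = p + (t * norm v) *\<^sub>R (v /\<^sub>R norm v)" for t using assms by simp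
  moreover have "p + t *\<^sub>R (v /\<^sub>R norm v) = p + (t / norm v) *\<^sub>R v" for t
    by (simp add: divide_inverse)
  ultimately show ?thesis unfolding line_through_def by blast
qed

lemma line_through_shift:
  assumes "q \<in> line_through p v"
  shows "line_through p v = line_through q v"
proof -
  obtain s where q: "q = p + s *\<^sub>R v" using assms by (auto simp: line_through_def)
  have "p + t *\<^sub>R v = q + (t - s) *\<^sub>R v" "q + t *\<^sub>R v = p + (t + s) *\<^sub>R v" for t
    by (simp_all add: q algebra_simps)
  then show ?thesis unfolding line_through_def by blast
qed

text \<open>Cramer's rule for \<open>p + t *\<^sub>R v = q + s *\<^sub>R w\<close>.\<close>

lemma line_through_meet:
  fixes p q v w :: "real^2"
  assumes "v$1 * w$2 - v$2 * w$1 \<noteq> 0"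
  shows "line_through p v \<inter> line_through q w \<noteq> {}"
proof -
  define \<delta> where "\<delta> = v$1 * w$2 - v$2 * w$1"
  define t where "t = ((q$1 - p$1) * w$2 - (q$2 - p$2) * w$1) / \<delta>"
  define s where "s = ((q$1 - p$1) * v$2 - (q$2 - p$2) * v$1) / \<delta>"
  have \<delta>0: "\<delta> \<noteq> 0" using assms by (simp add: \<delta>_def)
  have "\<delta> * (p$i + t * v$i) = \<delta> * (q$i + s * w$i)" if "i = 1 \<or> i = 2" for i
  proof -
    have e: "\<delta> * t = (q$1 - p$1) * w$2 - (q$2 - p$2) * w$1"
      "\<delta> * s = (q$1 - p$1) * v$2 - (q$2 - p$2) * v$1"
      using \<delta>0 by (simp_all add: t_def s_def)
    have "\<delta> * p$i + (\<delta> * t) * v$i = \<delta> * q$i + (\<delta> * s) * w$i"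
      using that unfolding e by (auto simp: \<delta>_def algebra_simps)
    then show ?thesis by (simp add: algebra_simps)
  qed
  then have "p + t *\<^sub>R v = q + s *\<^sub>R w"
    using \<delta>0 by (simp add: vec_eq_iff forall_2)
  then show ?thesis unfolding line_through_def by blast
qed

text \<open>The frame places the intersection point at parameter 0 on both lines and uses unit
  directions, so that \<open>inner u w\<close> is the cosine \<open>l\<close>.\<close>

lemma skew_lines_frame:
  assumes "is_line L1" "is_line L2" "\<not> parallel_or_orthogonal L1 L2"
  obtains q u w where "L1 = line_through q u" "L2 = line_through q w"
    "norm u = 1" "norm w = 1" "inner u w \<noteq> 0" "(inner u w)\<^sup>2 < 1"
proof -
  obtain p1 v1 p2 v2 where v: "v1 \<noteq> 0" "v2 \<noteq> 0"
    and L: "L1 = line_through p1 v1" "L2 = line_through p2 v2"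
    using assms(1,2) by (auto simp: is_line_def)
  define u w where "u = v1 /\<^sub>R norm v1" and "w = v2 /\<^sub>R norm v2"
  have n: "norm u = 1" "norm w = 1" using v by (simp_all add: u_def w_def)
  have L': "L1 = line_through p1 u" "L2 = line_through p2 w"
    unfolding L u_def w_def by (intro line_through_unit v)+
  have "u \<noteq> 0" "w \<noteq> 0" using n by auto
  \<comment> \<open>The predicate quantifies over all representations of the lines, so its negation
    applies to the normalised directions.\<close>
  then have *: "u$1 * w$2 - u$2 * w$1 \<noteq> 0" "inner u w \<noteq> 0"
    using assms(3) L' unfolding parallel_or_orthogonal_def by blast+
  obtain q where "q \<in> L1" "q \<in> L2" using line_through_meet[OF *(1), of p1 p2] L' by auto
  then have q: "q \<in> line_through p1 u" "q \<in> line_through p2 w" using L' by simp_all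
  have "L1 = line_through q u" "L2 = line_through q w"
    unfolding L' by (rule line_through_shift q)+
  moreover have "(inner u w)\<^sup>2 < 1"
  proof -
    have "(u$1)\<^sup>2 + (u$2)\<^sup>2 = 1" "(w$1)\<^sup>2 + (w$2)\<^sup>2 = 1"
      using n by (auto simp: norm_eq_sqrt_inner inner_vec_def sum_2 power2_eq_square)
    \<comment> \<open>Lagrange's identity, here the relation between cosine and sine.\<close>
    moreover have "(inner u w)\<^sup>2 + (u$1 * w$2 - u$2 * w$1)\<^sup>2
        = ((u$1)\<^sup>2 + (u$2)\<^sup>2) * ((w$1)\<^sup>2 + (w$2)\<^sup>2)"
      by (simp add: inner_vec_def sum_2 power2_eq_square algebra_simps)
    ultimately have "(inner u w)\<^sup>2 + (u$1 * w$2 - u$2 * w$1)\<^sup>2 = 1" by simp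
    moreover have "(u$1 * w$2 - u$2 * w$1)\<^sup>2 > 0" using *(1) by simp
    ultimately show ?thesis by linarith
  qed
  ultimately show thesis using that n *(2) by blast
qed

text \<open>This is the law of cosines.\<close>

lemma dist_frame:
  fixes u w q :: "'a::real_inner"
  assumes "norm u = 1" "norm w = 1"
  shows "dist (q + x *\<^sub>R u) (q + y *\<^sub>R w) = sqrt (sqdist (inner u w) x y)"
proof -
  have "inner u u = 1" "inner w w = 1" using assms by (simp_all add: norm_eq_1)
  then show ?thesis
    by (simp add: dist_norm norm_eq_sqrt_inner sqdist_def inner_diff_left inner_diff_right
        inner_commute power2_eq_square algebra_simps)
qed

lemma few_distances_imp_small:
  assumes L: "is_line L1" "is_line L2" "\<not> parallel_or_orthogonal L1 L2"
    and P: "P1 \<subseteq> L1" "P2 \<subseteq> L2" "finite P1" "finite P2" "4 \<le> card P1"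
    and D: "real (card (dist_set P1 P2)) \<le> c * real (card P1)"
    and T: "8 * c \<le> real T" "0 < T"
  shows "real (card P2) * (real (card P2) - 1) \<le> 16 * c\<^sup>2 * (2 * real T + 1)\<^sup>2 * real (card P1)"
proof -
  obtain q u w where quw: "L1 = line_through q u" "L2 = line_through q w"
    and n: "norm u = 1" "norm w = 1" and l: "inner u w \<noteq> 0" "(inner u w)\<^sup>2 < 1"
    using skew_lines_frame[OF L] .
  have inj: "inj_on (\<lambda>t. q + t *\<^sub>R u) Z" "inj_on (\<lambda>t. q + t *\<^sub>R w) Z" for Z
    using n by (auto simp: inj_on_def)
  obtain X where X: "P1 = (\<lambda>t. q + t *\<^sub>R u) ` X"
    using P(1) unfolding quw line_through_eq_range subset_image_iff by blast
  obtain Y where Y: "P2 = (\<lambda>t. q + t *\<^sub>R w) ` Y"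
    using P(2) unfolding quw line_through_eq_range subset_image_iff by blast
  have cX: "card P1 = card X" "finite X" and cY: "card P2 = card Y" "finite Y"
    using inj P(3,4) unfolding X Y
    by (simp_all add: card_image finite_image_iff)
  define E where "E = (\<lambda>(x, y). sqdist (inner u w) x y) ` (X \<times> Y)"
  have "dist_set P1 P2 = sqrt ` E"
  proof -
    have "dist_set P1 P2 = {dist (q + x *\<^sub>R u) (q + y *\<^sub>R w) | x y. x \<in> X \<and> y \<in> Y}"
      unfolding dist_set_def X Y by blast
    also have "\<dots> = sqrt ` E"
      unfolding dist_frame[OF n] E_def by (auto simp: image_iff)
    finally show ?thesis .
  qed
  \<comment> \<open>In HOL \<open>sqrt\<close> is injective on all reals, so squaring preserves the
    number of distances.\<close>
  then have "card (dist_set P1 P2) = card E"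
    by (simp add: card_image inj_on_def)
  then show ?thesis
    using few_sqdist_imp_small[OF cX(2) cY(2) l E_def _ T] D P(5) cX cY by simp
qed

text \<open>For skew lines the square of \<open>card P2\<close> is at most a constant times
  \<open>n\<close>, which \<open>n powr (1 + 2 * \<epsilon>)\<close> eventually exceeds. The size of
  \<open>P2\<close> is bounded below because the power need not be an integer.\<close>

theorem theorem5p2:
  shows "\<forall>c::real>0. \<forall>\<epsilon>::real>0. \<exists>n0::nat. \<forall>n>n0. \<forall>L1 L2 P1 P2.
     is_line L1 \<longrightarrow> is_line L2 \<longrightarrow> P1 \<subseteq> L1 \<longrightarrow> P2 \<subseteq> L2 \<longrightarrow>
     finite P1 \<longrightarrow> card P1 = n \<longrightarrow> finite P2 \<longrightarrow> real (card P2) \<ge> real n powr (1/2 + \<epsilon>) \<longrightarrow>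
     real (card (dist_set P1 P2)) < c * real n \<longrightarrow> parallel_or_orthogonal L1 L2"
proof (intro allI impI)
  fix c \<epsilon> :: real assume c: "0 < c" and \<epsilon>: "0 < \<epsilon>"
  define T where "T = nat \<lceil>8 * c\<rceil>"
  have T: "8 * c \<le> real T" "0 < T"
    using c unfolding T_def by linarith+
  \<comment> \<open>This is twice the constant of \<open>few_distances_imp_small\<close>; the extra
    2 pays for \<open>\<mu>\<^sup>2 \<le> 2 * (\<mu> * (\<mu> - 1))\<close>.\<close>
  define K where "K = 32 * c\<^sup>2 * (2 * real T + 1)\<^sup>2"
  have "filterlim (\<lambda>n. real n powr (2 * \<epsilon>)) at_top sequentially"
    using \<epsilon> by real_asymp
  then have "eventually (\<lambda>n. K < real n powr (2 * \<epsilon>)) sequentially"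
    by (simp add: filterlim_at_top_dense)
  then obtain M where M: "\<And>n. M \<le> n \<Longrightarrow> K < real n powr (2 * \<epsilon>)"
    by (auto simp: eventually_sequentially)
  show "\<exists>n0::nat. \<forall>n>n0. \<forall>L1 L2 P1 P2.
     is_line L1 \<longrightarrow> is_line L2 \<longrightarrow> P1 \<subseteq> L1 \<longrightarrow> P2 \<subseteq> L2 \<longrightarrow>
     finite P1 \<longrightarrow> card P1 = n \<longrightarrow> finite P2 \<longrightarrow> real (card P2) \<ge> real n powr (1/2 + \<epsilon>) \<longrightarrow>
     real (card (dist_set P1 P2)) < c * real n \<longrightarrow> parallel_or_orthogonal L1 L2"
  \<comment> \<open>Beyond 4, both \<open>card P1 \<ge> 4\<close> and \<open>\<mu> \<ge> 2\<close>
    hold; beyond \<open>M\<close>, the power exceeds \<open>K\<close>.\<close>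
  proof (intro exI[of _ "max M 4"] allI impI, rule ccontr)
    fix n L1 L2 P1 P2
    assume n: "max M 4 < n" and L: "is_line L1" "is_line L2"
      and P: "P1 \<subseteq> L1" "P2 \<subseteq> L2" "finite P1" "card P1 = n" "finite P2"
      and m: "real n powr (1/2 + \<epsilon>) \<le> real (card P2)"
      and D: "real (card (dist_set P1 P2)) < c * real n"
      and neg: "\<not> parallel_or_orthogonal L1 L2"
    define \<mu> where "\<mu> = real (card P2)"
    have "real n powr (1/2) \<ge> 4 powr (1/2)" using n by (intro powr_mono2) auto
    moreover have "real n powr (1/2) \<le> real n powr (1/2 + \<epsilon>)"
      using n \<epsilon> by (intro powr_mono) auto
    moreover have "(4::real) powr (1/2) = 2" by (simp add: powr_half_sqrt)
    ultimately have \<mu>2: "2 \<le> \<mu>" using m by (simp add: \<mu>_def)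
    have "\<mu> * (\<mu> - 1) \<le> K / 2 * n"
      using few_distances_imp_small[OF L neg P(1,2,3,5) _ _ T] D P(4) n
      by (simp add: \<mu>_def K_def)
    then have "2 * (\<mu> * (\<mu> - 1)) \<le> K * n" by simp
    moreover have "\<mu>\<^sup>2 \<le> 2 * (\<mu> * (\<mu> - 1))"
      using mult_left_mono[OF \<mu>2, of \<mu>] \<mu>2 by (simp add: power2_eq_square algebra_simps)
    moreover have "K * real n < real n powr (2 * \<epsilon>) * real n"
      using M[of n] n by simp
    moreover have "real n powr (2 * \<epsilon>) * real n = (real n powr (1/2 + \<epsilon>))\<^sup>2"
    proof -
      have "(real n powr (1/2 + \<epsilon>))\<^sup>2 = real n powr (2 * \<epsilon> + 1)"
        by (simp add: power2_eq_square powr_add[symmetric] add.commute)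
      then show ?thesis using n by (simp add: powr_add)
    qed
    moreover have "(real n powr (1/2 + \<epsilon>))\<^sup>2 \<le> \<mu>\<^sup>2"
      using m by (intro power_mono) (auto simp: \<mu>_def)
    ultimately show False by linarith
  qed
qed

end
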